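(* Let $p$ be a prime with $p\equiv 1\pmod 4$ and let $\alpha$ be a positive integer. Let $\chi$ be the unique quadratic (order $2$) Dirichlet character modulo $p^\alpha$, let $\psi$ be a Dirichlet character modulo $p^\alpha$ of order $4$, and let $J(\psi,\chi)=\sum_{x\in\mathbb{Z}_{p^\alpha}}\psi(x)\chi(1-x)$. Then $$\mathcal{K}_4(G_{p^{\alpha}})=\frac{p^{2\alpha-1}(p-1)\left[p^{2\alpha-2}\left\{(p-9)^2-2p\right\}+J(\psi,\chi)^2+\overline{J(\psi,\chi)}^2\right]}{1536}.$$
   Context: For a positive integer $n$, $\mathbb{Z}_n$ denotes the ring of integers modulo $n$ and $\mathbb{Z}_n^{\ast}$ its group of units. The graph $G_n$ has vertex set $\mathbb{Z}_n$, and two distinct vertices $a,b$ are adjacent if and only if $a-b\equiv x^2\pmod n$ for some $x\in\mathbb{Z}_n^{\ast}$. For a graph $G$, $\mathcal{K}_m(G)$ denotes the number of complete subgraphs of order $m$ in $G$. Dirichlet characters modulo $n$ are regarded as functions on $\mathbb{Z}_n$ taking the value $0$ on non-units; since $\mathbb{Z}_{p^\alpha}^{\ast}$ is cyclic, there is a unique character of order $2$ and characters of order $4$ exist. *)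

theory Defs
  imports
    Complex_Main
    "HOL-Number_Theory.Number_Theory"
    "Graph_Theory.Graph_Theory"
begin

text \<open>
  The ring of integers modulo \<open>n\<close> is represented by the residues \<open>{0..<int n}\<close>, with equality in
  the ring expressed as congruence modulo \<open>n\<close>; its units are the residues coprime to \<open>n\<close>.

  An undirected graph is a symmetric digraph, so each edge is a pair of opposite arcs. The relation
  below is symmetric if \<open>-1\<close> is the square of a unit modulo \<open>n\<close>, in particular if \<open>n\<close> is a
  power of a prime congruent to \<open>1\<close> modulo \<open>4\<close>.
\<close>

definition unit_square_graph :: "nat \<Rightarrow> (int, int \<times> int) pre_digraph" where
  "unit_square_graph n =
    \<lparr> verts = {0..<int n},
      arcs = {(a, b). a \<in> {0..<int n} \<and> b \<in> {0..<int n} \<and> a \<noteq> b \<and>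
                (\<exists>x\<in>{0..<int n}. coprime x (int n) \<and> [a - b = x ^ 2] (mod int n))},
      tail = fst, head = snd \<rparr>"

definition num_complete_subgraphs :: "nat \<Rightarrow> ('a, 'b) pre_digraph \<Rightarrow> nat" where
  "num_complete_subgraphs m G = card {H. subgraph H G \<and> complete_digraph m H}"

text \<open>A function on the integers modulo \<open>n\<close> is represented by its \<open>n\<close>-periodic lift to the integers.\<close>

definition dirichlet_character :: "nat \<Rightarrow> (int \<Rightarrow> complex) \<Rightarrow> bool" where
  "dirichlet_character n \<chi> \<longleftrightarrow>
     (\<forall>a b. [a = b] (mod int n) \<longrightarrow> \<chi> a = \<chi> b) \<and>
     (\<forall>a. \<chi> a \<noteq> 0 \<longleftrightarrow> coprime a (int n)) \<and>
     \<chi> 1 = 1 \<and>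
     (\<forall>a b. \<chi> (a * b) = \<chi> a * \<chi> b)"

text \<open>The order in the group of characters, whose identity is \<open>1\<close> on every unit.\<close>

definition character_order :: "nat \<Rightarrow> (int \<Rightarrow> complex) \<Rightarrow> nat" where
  "character_order n \<chi> = (LEAST k. k > 0 \<and> (\<forall>a. coprime a (int n) \<longrightarrow> \<chi> a ^ k = 1))"

definition jacobi_sum :: "nat \<Rightarrow> (int \<Rightarrow> complex) \<Rightarrow> (int \<Rightarrow> complex) \<Rightarrow> complex" where
  "jacobi_sum n \<psi> \<chi> = (\<Sum>x\<in>{0..<int n}. \<psi> x * \<chi> (1 - x))"

end

theory Submission
  imports Defs "HOL-Combinatorics.Multiset_Permutations"
begin

text \<open>
  Both characters are \<open>p\<close>-periodic, so everything is a \<open>p ^ (\<alpha> - 1)\<close>-fold blow-up of the case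
  \<open>\<alpha> = 1\<close>. There, translating and scaling a clique so that it contains \<open>0\<close> and \<open>1\<close> leaves a sum over
  pairs of common neighbours \<open>x\<close>, \<open>y\<close>. Expanding the indicators of squares by \<open>\<chi>\<close> reduces it
  to elementary sums and
  \[T = \sum_{x,y} \chi(x(1-x)) \chi(y(1-y)) \chi(x-y).\]
  Since \<open>\<psi>(t)\<close> plus its conjugate is the sum of \<open>\<chi>(w)\<close> over the square roots \<open>w\<close> of \<open>t\<close>, the sum
  \<open>J\<^sup>2\<close> plus its conjugate becomes
  \[\sum_{w^2=uv} \chi(w)\chi(1-u)\chi(1-v) = \sum_{w,s} \chi(w + w^{-1} - s - s^{-1}),\]
  upon putting \<open>u = ws\<close> and \<open>v = w/s\<close>. The equation \<open>w + 1/w = r\<close> has \<open>1 + \<chi>(r\<^sup>2 - 4)\<close> solutions, and only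
  the product of the two characters \<open>\<chi>(r\<^sup>2 - 4)\<close>, \<open>\<chi>(q\<^sup>2 - 4)\<close> survives the summation against \<open>\<chi>(r - q)\<close>;
  the substitution \<open>r = 4x - 2\<close>, \<open>q = 4y - 2\<close> turns the result into \<open>T\<close>.
\<close>

section \<open>Sums of periodic functions\<close>

text \<open>Polynomial arguments respect congruence and characters are periodic in their argument,
  so the periodicity of a nested sum follows from closure rules applied along its syntax.\<close>

definition congruence_preserving :: "nat \<Rightarrow> (int \<Rightarrow> int) \<Rightarrow> bool" where
  "congruence_preserving m h \<longleftrightarrow> (\<forall>a b. [a = b] (mod int m) \<longrightarrow> [h a = h b] (mod int m))"

definition periodic :: "nat \<Rightarrow> (int \<Rightarrow> 'a) \<Rightarrow> bool" where
  "periodic m f \<longleftrightarrow> (\<forall>a b. [a = b] (mod int m) \<longrightarrow> f a = f b)"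

lemma periodicD: "periodic m f \<Longrightarrow> [a = b] (mod int m) \<Longrightarrow> f a = f b"
  by (auto simp: periodic_def)

lemma congruence_preserving_intros:
  "congruence_preserving m (\<lambda>x. c)"
  "congruence_preserving m (\<lambda>x. x)"
  "congruence_preserving m h \<Longrightarrow> congruence_preserving m k \<Longrightarrow> congruence_preserving m (\<lambda>x. h x + k x)"
  "congruence_preserving m h \<Longrightarrow> congruence_preserving m k \<Longrightarrow> congruence_preserving m (\<lambda>x. h x - k x)"
  "congruence_preserving m h \<Longrightarrow> congruence_preserving m k \<Longrightarrow> congruence_preserving m (\<lambda>x. h x * k x)"
  "congruence_preserving m h \<Longrightarrow> congruence_preserving m (\<lambda>x. h x ^ j)"
  unfolding congruence_preserving_def
  by (auto intro: cong_add cong_diff cong_mult cong_pow)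

lemma periodic_compose:
  "periodic m f \<Longrightarrow> congruence_preserving m h \<Longrightarrow> periodic m (\<lambda>x. f (h x))"
  by (auto simp: periodic_def congruence_preserving_def)

lemma periodic_intros:
  "periodic m (\<lambda>x. c)"
  "periodic m f \<Longrightarrow> periodic m g \<Longrightarrow> periodic m (\<lambda>x. f x + g x :: complex)"
  "periodic m f \<Longrightarrow> periodic m g \<Longrightarrow> periodic m (\<lambda>x. f x - g x :: complex)"
  "periodic m f \<Longrightarrow> periodic m g \<Longrightarrow> periodic m (\<lambda>x. f x * g x :: complex)"
  "periodic m f \<Longrightarrow> periodic m (\<lambda>x. f x ^ j :: complex)"
  "periodic m f \<Longrightarrow> periodic m (\<lambda>x. f x / c :: complex)"
  "periodic m f \<Longrightarrow> periodic m (\<lambda>x. cnj (f x))"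
  "(\<And>y. periodic m (\<lambda>x. F x y)) \<Longrightarrow> periodic m (\<lambda>x. \<Sum>y\<in>Y. F x y :: complex)"
  unfolding periodic_def by (safe, (rule sum.cong[OF refl], blast | metis)+)

text \<open>A map that is injective modulo \<open>m\<close> permutes the finite set of residues, and
  a periodic \<open>f\<close> sees only residues.\<close>

lemma sum_reindex_mod:
  fixes f :: "int \<Rightarrow> 'a::comm_monoid_add"
  assumes "m > 0" and f: "periodic m f"
    and h: "\<And>a b. [h a = h b] (mod int m) \<Longrightarrow> [a = b] (mod int m)"
  shows "(\<Sum>x\<in>{0..<int m}. f (h x)) = (\<Sum>x\<in>{0..<int m}. f x)"
proof -
  let ?P = "{0..<int m}" and ?h = "\<lambda>x. h x mod int m"
  have "inj_on ?h ?P"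
  proof (rule inj_onI)
    fix x y assume "x \<in> ?P" "y \<in> ?P" "?h x = ?h y"
    with h[of x y] show "x = y" by (auto simp: cong_def)
  qed
  moreover have "?h ` ?P \<subseteq> ?P"
    using \<open>m > 0\<close> by auto
  ultimately have "bij_betw ?h ?P ?P"
    by (simp add: bij_betw_def endo_inj_surj)
  from sum.reindex_bij_betw[OF this, of f]
  have "(\<Sum>x\<in>?P. f (?h x)) = sum f ?P" .
  moreover have "f (?h x) = f (h x)" for x
    by (rule periodicD[OF f]) simp
  ultimately show ?thesis by simp
qed

lemma sum_affine_mod:
  fixes f :: "int \<Rightarrow> 'a::comm_monoid_add"
  assumes "m > 0" and f: "periodic m f" and c: "coprime c (int m)"
  shows "(\<Sum>x\<in>{0..<int m}. f (c * x + d)) = (\<Sum>x\<in>{0..<int m}. f x)"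
proof (rule sum_reindex_mod[OF assms(1) f])
  fix a b assume "[c * a + d = c * b + d] (mod int m)"
  then have "[c * a = c * b] (mod int m)" by (simp add: cong_add_rcancel)
  with c show "[a = b] (mod int m)" by (simp add: cong_mult_lcancel)
qed

text \<open>The range consists of \<open>k\<close> blocks of \<open>m\<close> consecutive integers,
  each a complete residue system. This performs the blow-up from \<open>p\<close> to
  \<open>p ^ \<alpha>\<close>.\<close>

lemma sum_periodic_multiple:
  fixes f :: "int \<Rightarrow> 'a::comm_semiring_1"
  assumes f: "periodic m f"
  shows "(\<Sum>x\<in>{0..<int (k * m)}. f x) = of_nat k * (\<Sum>x\<in>{0..<int m}. f x)"
proof (induction k)
  case (Suc k)
  have "{0..<int (Suc k * m)} = {0..<int (k * m)} \<union> (\<lambda>x. x + int (k * m)) ` {0..<int m}"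
    by (subst image_add_atLeastLessThan') (auto simp: algebra_simps ivl_disj_un)
  then have "(\<Sum>x\<in>{0..<int (Suc k * m)}. f x)
      = (\<Sum>x\<in>{0..<int (k * m)}. f x) + (\<Sum>x\<in>(\<lambda>x. x + int (k * m)) ` {0..<int m}. f x)"
    by (simp only:) (rule sum.union_disjoint; auto)
  also have "(\<Sum>x\<in>(\<lambda>x. x + int (k * m)) ` {0..<int m}. f x) = (\<Sum>x\<in>{0..<int m}. f (x + int (k * m)))"
    by (subst sum.reindex) auto
  also have "\<dots> = (\<Sum>x\<in>{0..<int m}. f x)"
    by (intro sum.cong refl periodicD[OF f]) (simp add: cong_def)
  finally show ?case unfolding Suc.IH by (simp add: algebra_simps)
qed simp

section \<open>Sums of quadratic characters modulo a prime\<close>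

text \<open>What survives of two characters of orders 2 and 4 modulo \<open>p ^ \<alpha>\<close>
  after the descent to \<open>p\<close>. The condition \<open>[p = 1] (mod 4)\<close> acts here
  through \<open>psi_square\<close>, which makes \<open>\<chi>\<close> even.\<close>

locale quartic_character =
  fixes p :: nat and \<chi> \<psi> :: "int \<Rightarrow> complex"
  assumes prime: "prime p" and gt_2: "p > 2"
    and chi: "dirichlet_character p \<chi>" and psi: "dirichlet_character p \<psi>"
    and psi_square: "\<psi> a ^ 2 = \<chi> a"
    and chi_unit: "coprime a (int p) \<Longrightarrow> \<chi> a = 1 \<or> \<chi> a = -1"
    and chi_square_root: "\<chi> a = 1 \<Longrightarrow> \<exists>x. [a = x ^ 2] (mod int p)"
    and chi_nontrivial: "\<exists>g. \<chi> g = -1"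
begin

abbreviation residue_range :: "int set" ("P") where "P \<equiv> {0..<int p}"

text \<open>A delta function with complex values: constraints such as \<open>w ^ 2 = t\<close> or
  \<open>x * y = 1\<close> become factors of the summand, and sums can then be exchanged
  freely.\<close>

definition D :: "int \<Rightarrow> complex" where
  "D a = of_bool (int p dvd a)"

section \<open>Elementary values of the characters\<close>

lemma prime_int: "prime (int p)"
  using prime by simp

lemma p_pos: "p > 0"
  using gt_2 by simp

lemma coprime_iff: "coprime a (int p) \<longleftrightarrow> \<not> int p dvd a"
  using prime_int by (meson coprime_commute prime_imp_coprime coprime_absorb_left not_prime_unit)

lemma chi_periodic: "periodic p \<chi>" and psi_periodic: "periodic p \<psi>"
  using chi psi by (auto simp: dirichlet_character_def periodic_def)

lemma D_periodic: "periodic p D"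
  by (auto simp: periodic_def D_def cong_dvd_iff)

lemmas periodicity = periodic_intros congruence_preserving_intros
  periodic_compose[OF chi_periodic] periodic_compose[OF psi_periodic] periodic_compose[OF D_periodic]

lemma chi_mult: "\<chi> (a * b) = \<chi> a * \<chi> b" and psi_mult: "\<psi> (a * b) = \<psi> a * \<psi> b"
  using chi psi by (auto simp: dirichlet_character_def)

lemma chi_1 [simp]: "\<chi> 1 = 1" and psi_1 [simp]: "\<psi> 1 = 1"
  using chi psi by (auto simp: dirichlet_character_def)

lemma chi_eq_0_iff: "\<chi> a = 0 \<longleftrightarrow> int p dvd a" and psi_eq_0_iff: "\<psi> a = 0 \<longleftrightarrow> int p dvd a"
  using chi psi by (auto simp: dirichlet_character_def coprime_iff)

lemma chi_0 [simp]: "\<chi> 0 = 0"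
  by (simp add: chi_eq_0_iff)

lemma chi_cases:
  obtains (zero) "int p dvd a" "\<chi> a = 0" | (one) "\<not> int p dvd a" "\<chi> a = 1"
    | (minus_one) "\<not> int p dvd a" "\<chi> a = -1"
  using chi_unit[of a] by (auto simp: coprime_iff chi_eq_0_iff)

lemma chi_mult_self: "\<chi> a * \<chi> a = 1 - D a"
  by (cases a rule: chi_cases) (auto simp: D_def)

lemma cnj_chi [simp]: "cnj (\<chi> a) = \<chi> a"
  by (cases a rule: chi_cases) auto

lemma chi_power2: "\<chi> (a ^ 2) = 1 - D a"
  by (simp add: power2_eq_square chi_mult chi_mult_self)

text \<open>\<open>\<chi>\<close> is the square of \<open>\<psi>\<close>, so its value at -1 is that
  of \<open>\<psi>\<close> at 1. Evenness makes adjacency symmetric and lets differences be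
  reversed.\<close>

lemma chi_minus_1: "\<chi> (-1) = 1"
proof -
  have "\<psi> (-1) * \<psi> (-1) = \<psi> 1"
    by (simp flip: psi_mult)
  then show ?thesis
    using psi_square[of "-1"] by (simp add: power2_eq_square)
qed

lemma chi_minus [simp]: "\<chi> (- a) = \<chi> a"
  using chi_mult[of "-1" a] by (simp add: chi_minus_1)

lemma chi_minus_commute: "\<chi> (a - b) = \<chi> (b - a)"
  using chi_minus[of "a - b"] by simp

lemma not_dvd_2: "\<not> int p dvd 2"
  using gt_2 zdvd_imp_le[of "int p" 2] by auto

lemma not_dvd_4: "\<not> int p dvd 4"
  using not_dvd_2 prime_int prime_dvd_mult_iff[of "int p" 2 2] by simp

lemma chi_4 [simp]: "\<chi> 4 = 1"
  using chi_power2[of 2] not_dvd_2 by (simp add: D_def)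

lemma dvd_mult_iff: "int p dvd a * b \<longleftrightarrow> int p dvd a \<or> int p dvd b"
  by (rule prime_dvd_mult_iff[OF prime_int])

lemma D_mult_unit: "\<not> int p dvd c \<Longrightarrow> D (c * a) = D a"
  by (simp add: D_def dvd_mult_iff)

lemma D_minus_commute: "D (a - b) = D (b - a)"
  by (simp add: D_def dvd_diff_commute)

section \<open>Complete sums and the delta function\<close>

lemma sum_affine:
  fixes f :: "int \<Rightarrow> complex"
  assumes "periodic p f" "\<not> int p dvd c"
  shows "(\<Sum>x\<in>P. f (c * x + d)) = (\<Sum>x\<in>P. f x)"
  using assms p_pos by (intro sum_affine_mod) (auto simp: coprime_iff)

lemma sum_D:
  assumes "periodic p f"
  shows "(\<Sum>x\<in>P. D (x - y) * f x) = f y"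
proof -
  have "D (x - y) = of_bool (x = y mod int p)" if "x \<in> P" for x
  proof -
    have "int p dvd x - y \<longleftrightarrow> [x = y] (mod int p)" by (simp add: cong_iff_dvd_diff)
    also have "\<dots> \<longleftrightarrow> x = y mod int p" using that by (auto simp: cong_def)
    finally show ?thesis by (simp add: D_def)
  qed
  then have "(\<Sum>x\<in>P. D (x - y) * f x) = (\<Sum>x\<in>P. if x = y mod int p then f x else 0)"
    by (intro sum.cong refl) (simp add: of_bool_def)
  also have "\<dots> = f (y mod int p)"
    using p_pos by (simp add: sum.delta)
  also have "\<dots> = f y"
    by (rule periodicD[OF assms]) simp
  finally show ?thesis .
qed

text \<open>Scaling by a non-residue \<open>g\<close> permutes the residues but changes the sign of
  every term.\<close>

lemma sum_chi: "(\<Sum>x\<in>P. \<chi> x) = 0"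
proof -
  obtain g where g: "\<chi> g = -1" using chi_nontrivial by blast
  then have "\<not> int p dvd g" by (auto simp flip: chi_eq_0_iff)
  from sum_affine[OF chi_periodic this, of 0]
  have "(\<Sum>x\<in>P. \<chi> (g * x)) = (\<Sum>x\<in>P. \<chi> x)" by simp
  then show ?thesis by (simp add: chi_mult g sum_negf)
qed

lemma sum_chi_affine: "\<not> int p dvd c \<Longrightarrow> (\<Sum>x\<in>P. \<chi> (c * x + d)) = 0"
  using sum_affine[OF chi_periodic] sum_chi by simp

lemma sum_chi_minus: "(\<Sum>x\<in>P. \<chi> (x - y)) = 0" "(\<Sum>x\<in>P. \<chi> (y - x)) = 0"
  using sum_chi_affine[of 1 "-y"] sum_chi_affine[of "-1" y] gt_2
  by auto

section \<open>The hyperbola \<open>x * y = 1\<close> and products of two quadratic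
  characters\<close>

text \<open>A unit has one inverse, a multiple of \<open>p\<close> none. Read from right to left,
  this inserts the inverse of \<open>y\<close> as a new summation variable.\<close>

lemma sum_D_hyperbola: "(\<Sum>x\<in>P. D (1 - x * y)) = 1 - D y"
proof (cases "int p dvd y")
  case True
  then have "D (1 - x * y) = 0" for x
    using prime_int by (auto simp: D_def dvd_diff_right_iff dvd_diff_left_iff not_prime_unit)
  with True show ?thesis by (simp add: D_def)
next
  case False
  have "(\<Sum>x\<in>P. D (1 - x * y)) = (\<Sum>x\<in>P. D (y * x + (-1)))"
    by (intro sum.cong refl) (subst D_minus_commute, simp add: mult.commute)
  also have "\<dots> = (\<Sum>x\<in>P. D x)"
    by (rule sum_affine[OF D_periodic False])
  also have "\<dots> = 1"
    using sum_D[of "\<lambda>_. 1" 0] by (simp add: periodic_intros)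
  finally show ?thesis using False by (simp add: D_def)
qed

lemma hyperbola_chi: "D (1 - x * y) * \<chi> x = D (1 - x * y) * \<chi> y"
proof (cases "int p dvd 1 - x * y")
  case True
  then have "\<chi> 1 = \<chi> (x * y)"
    by (intro periodicD[OF chi_periodic]) (simp add: cong_iff_dvd_diff)
  then have "\<chi> x = \<chi> y"
    by (cases x rule: chi_cases; cases y rule: chi_cases) (auto simp: chi_mult)
  then show ?thesis by simp
qed (simp add: D_def)

text \<open>If \<open>y\<close> is the inverse of \<open>x\<close>, then
  \<open>\<chi> x = \<chi> y\<close> and \<open>y * (1 - x) = y - 1\<close> modulo \<open>p\<close>,
  so the term is \<open>\<chi> (y - 1)\<close>. As \<open>y\<close> runs over the units only, the
  complete sum 0 loses its term at 0, which is 1.\<close>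

lemma sum_chi_chi_1: "(\<Sum>x\<in>P. \<chi> x * \<chi> (1 - x)) = -1"
proof -
  have "(\<Sum>x\<in>P. \<chi> x * \<chi> (1 - x)) = (\<Sum>x\<in>P. (\<Sum>y\<in>P. D (1 - y * x)) * \<chi> x * \<chi> (1 - x))"
    by (intro sum.cong refl, subst sum_D_hyperbola)
       (auto simp: D_def chi_eq_0_iff)
  also have "\<dots> = (\<Sum>x\<in>P. \<Sum>y\<in>P. D (1 - y * x) * (1 - D y) * \<chi> (y - 1))"
    unfolding sum_distrib_right
  proof (intro sum.cong refl)
    fix x y
    show "D (1 - y * x) * \<chi> x * \<chi> (1 - x) = D (1 - y * x) * (1 - D y) * \<chi> (y - 1)"
    proof (cases "int p dvd 1 - y * x")
      case True
      have "\<chi> (y * (1 - x)) = \<chi> (y - 1)"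
      proof (rule periodicD[OF chi_periodic])
        have "y * (1 - x) - (y - 1) = 1 - y * x" by (simp add: algebra_simps)
        with True show "[y * (1 - x) = y - 1] (mod int p)" by (simp only: cong_iff_dvd_diff)
      qed
      moreover have "\<chi> y \<noteq> 0"
        using True prime_int by (auto simp: chi_eq_0_iff dvd_diff_left_iff not_prime_unit)
      moreover have "\<chi> x = \<chi> y"
        using hyperbola_chi[of y x] True by (simp add: D_def)
      ultimately show ?thesis
        by (simp add: chi_mult) (simp add: D_def chi_eq_0_iff)
    qed (simp add: D_def)
  qed
  also have "\<dots> = (\<Sum>y\<in>P. (\<Sum>x\<in>P. D (1 - x * y)) * ((1 - D y) * \<chi> (y - 1)))"
    by (subst sum.swap) (simp add: sum_distrib_left sum_distrib_right mult_ac)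
  also have "\<dots> = (\<Sum>y\<in>P. \<chi> (y - 1) - D (y - 0) * \<chi> (y - 1))"
    unfolding sum_D_hyperbola by (intro sum.cong refl) (simp add: D_def)
  also have "\<dots> = -1"
    unfolding sum_subtractf sum_chi_minus
    by (subst sum_D) (auto intro!: periodicity simp: chi_minus_1)
  finally show ?thesis .
qed

text \<open>For a unit \<open>y\<close>, substituting \<open>y * x\<close> for \<open>x\<close>
  extracts \<open>\<chi> y\<close> twice and leads back to \<open>sum_chi_chi_1\<close>; for
  \<open>y = 0\<close> the terms are squares.\<close>

lemma sum_chi_chi_shift: "(\<Sum>x\<in>P. \<chi> x * \<chi> (x - y)) = of_nat p * D y - 1"
proof (cases "int p dvd y")
  case True
  have "(\<Sum>x\<in>P. \<chi> x * \<chi> (x - y)) = (\<Sum>x\<in>P. 1 - D (x - 0) * 1)"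
  proof (intro sum.cong refl)
    fix x
    have "\<chi> (x - y) = \<chi> x"
      by (rule periodicD[OF chi_periodic]) (use True in \<open>simp add: cong_iff_dvd_diff\<close>)
    then show "\<chi> x * \<chi> (x - y) = 1 - D (x - 0) * 1" by (simp add: chi_mult_self)
  qed
  also have "\<dots> = of_nat p - 1"
    unfolding sum_subtractf by (subst sum_D) (auto intro: periodicity)
  finally show ?thesis using True by (simp add: D_def)
next
  case False
  have "(\<Sum>x\<in>P. \<chi> x * \<chi> (x - y)) = (\<Sum>x\<in>P. \<chi> (y * x + 0) * \<chi> (y * x + 0 - y))"
    by (rule sum_affine[symmetric, OF _ False]) (intro periodicity)
  also have "\<dots> = (\<Sum>x\<in>P. \<chi> x * \<chi> (1 - x))"
  proof (intro sum.cong refl)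
    fix x
    have "\<chi> (y * x + 0 - y) = \<chi> (y * (x - 1))" by (simp add: algebra_simps)
    then show "\<chi> (y * x + 0) * \<chi> (y * x + 0 - y) = \<chi> x * \<chi> (1 - x)"
      using False chi_mult_self[of y] by (simp add: chi_mult chi_minus_commute[of x] D_def mult_ac)
  qed
  finally show ?thesis using False by (simp add: sum_chi_chi_1 D_def)
qed

section \<open>Square roots and the quartic character\<close>

lemma D_cong: "[a = b] (mod int p) \<Longrightarrow> D a = D b"
  by (rule periodicD[OF D_periodic])

lemma sum_D_1: "(\<Sum>x\<in>P. D (x - y)) = 1"
  using sum_D[of "\<lambda>_. 1" y] by (simp add: periodic_intros)

text \<open>The factors \<open>v - c\<close> and \<open>v + c\<close> of
  \<open>v ^ 2 - c ^ 2\<close> cannot vanish together because \<open>p\<close> does not divide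
  \<open>2 * c\<close>; hence the delta of the product is the sum of two deltas.\<close>

lemma sum_square_roots:
  assumes c: "\<not> int p dvd c" and d: "[d = c ^ 2] (mod int p)" and f: "periodic p f"
  shows "(\<Sum>v\<in>P. D (v ^ 2 - d) * f v) = f c + f (- c)"
proof -
  have "D (v ^ 2 - d) = D (v - c) + D (v - (- c))" for v
  proof -
    have "D (v ^ 2 - d) = D ((v - c) * (v + c))"
      using d by (intro D_cong) (simp add: algebra_simps power2_eq_square cong_diff)
    moreover have "\<not> (int p dvd v - c \<and> int p dvd v + c)"
    proof
      assume "int p dvd v - c \<and> int p dvd v + c"
      then have "int p dvd (v + c) - (v - c)" by (blast intro: dvd_diff)
      then have "int p dvd 2 * c" by simp
      with c not_dvd_2 show False by (simp add: dvd_mult_iff)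
    qed
    ultimately show ?thesis
      by (cases "int p dvd v - c"; cases "int p dvd v + c") (simp_all add: D_def dvd_mult_iff)
  qed
  then show ?thesis
    by (simp add: distrib_right sum.distrib sum_D[OF f] del: diff_minus_eq_add)
qed

lemma non_square: "\<chi> d = -1 \<Longrightarrow> D (v ^ 2 - d) = 0"
proof (rule ccontr)
  assume d: "\<chi> d = -1" and "D (v ^ 2 - d) \<noteq> 0"
  then have "[v ^ 2 = d] (mod int p)" by (simp add: D_def cong_iff_dvd_diff)
  then have "\<chi> (v ^ 2) = \<chi> d" by (rule periodicD[OF chi_periodic])
  with d show False by (cases "int p dvd v") (auto simp: chi_power2 D_def)
qed

lemma chi_oneE:
  assumes "\<chi> d = 1"
  obtains c where "\<not> int p dvd c" "[d = c ^ 2] (mod int p)"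
proof -
  from chi_square_root[OF assms] obtain c where c: "[d = c ^ 2] (mod int p)" by blast
  then have "\<chi> d = \<chi> (c ^ 2)" by (rule periodicD[OF chi_periodic])
  with assms c that show thesis by (auto simp: chi_power2 D_def)
qed

lemma number_square_roots: "(\<Sum>v\<in>P. D (v ^ 2 - d)) = 1 + \<chi> d"
proof (cases d rule: chi_cases)
  case zero
  have "D (v ^ 2 - d) = D (v - 0)" for v
    using zero prime_int by (simp add: D_def dvd_diff_left_iff prime_dvd_power_iff)
  with zero show ?thesis by (simp only: sum_D_1) simp
next
  case one
  from chi_oneE[OF this(2)] obtain c where "\<not> int p dvd c" "[d = c ^ 2] (mod int p)" .
  from sum_square_roots[OF this, of "\<lambda>_. 1"] one show ?thesis
    by (simp add: periodic_intros)
qed (simp add: non_square)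

text \<open>If \<open>t = c ^ 2\<close>, then \<open>\<psi> t = \<chi> c\<close> is real and the
  roots \<open>c\<close> and \<open>-c\<close> contribute the same value. If \<open>t\<close> is a
  non-square, there are no roots and \<open>\<psi> t\<close> is \<open>\<i>\<close> or
  \<open>-\<i>\<close>, which its conjugate cancels.\<close>

lemma psi_plus_cnj: "\<psi> t + cnj (\<psi> t) = (\<Sum>w\<in>P. D (w ^ 2 - t) * \<chi> w)"
proof (cases t rule: chi_cases)
  case zero
  have "D (w ^ 2 - t) * \<chi> w = 0" for w
    using zero prime_int by (simp add: D_def dvd_diff_left_iff prime_dvd_power_iff chi_eq_0_iff)
  then have "(\<Sum>w\<in>P. D (w ^ 2 - t) * \<chi> w) = 0" by (intro sum.neutral) blast
  moreover have "\<psi> t = 0" using zero by (simp add: psi_eq_0_iff)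
  ultimately show ?thesis by simp
next
  case one
  from chi_oneE[OF this(2)] obtain c where c: "\<not> int p dvd c" "[t = c ^ 2] (mod int p)" .
  have "\<psi> t = \<psi> (c ^ 2)" by (rule periodicD[OF psi_periodic c(2)])
  also have "\<dots> = \<chi> c" by (simp add: power2_eq_square psi_mult flip: psi_square)
  finally show ?thesis by (simp add: sum_square_roots[OF c chi_periodic])
next
  case minus_one
  have "\<psi> t ^ 2 = \<i> ^ 2" using psi_square[of t] minus_one by simp
  then have "\<psi> t + cnj (\<psi> t) = 0" unfolding power2_eq_iff by auto
  with minus_one show ?thesis by (simp add: non_square)
qed

section \<open>From the Jacobi sum to \<open>T\<close>\<close>

text \<open>Points of the hyperbola with \<open>w + v = r\<close> are roots of
  \<open>w ^ 2 - w * r + 1\<close>, whose discriminant is \<open>r ^ 2 - 4\<close>.\<close>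

lemma sum_hyperbola:
  assumes f: "periodic p f"
  shows "(\<Sum>w\<in>P. \<Sum>v\<in>P. D (1 - w * v) * f (w + v)) = (\<Sum>r\<in>P. (1 + \<chi> (r ^ 2 - 4)) * f r)"
proof -
  have "(\<Sum>r\<in>P. (1 + \<chi> (r ^ 2 - 4)) * f r) = (\<Sum>r\<in>P. \<Sum>v\<in>P. D (v ^ 2 - (r ^ 2 - 4)) * f r)"
    by (simp only: number_square_roots flip: sum_distrib_right)
  also have "\<dots> = (\<Sum>r\<in>P. \<Sum>w\<in>P. D (w ^ 2 - w * r + 1) * f r)"
  proof (rule sum.cong[OF refl])
    fix r
    \<comment> \<open>Completing the square: \<open>v = 2 * w - r\<close> turns
      \<open>v ^ 2 - (r ^ 2 - 4)\<close> into 4 times the quadratic in \<open>w\<close>.\<close>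
    have "(\<Sum>v\<in>P. D (v ^ 2 - (r ^ 2 - 4)) * f r)
        = (\<Sum>w\<in>P. D ((2 * w + (- r)) ^ 2 - (r ^ 2 - 4)) * f r)"
      by (rule sum_affine[symmetric, OF _ not_dvd_2]) (intro periodicity)
    also have "\<dots> = (\<Sum>w\<in>P. D (4 * (w ^ 2 - w * r + 1)) * f r)"
      by (simp add: power2_eq_square algebra_simps)
    finally show "(\<Sum>v\<in>P. D (v ^ 2 - (r ^ 2 - 4)) * f r) = (\<Sum>w\<in>P. D (w ^ 2 - w * r + 1) * f r)"
      by (simp only: D_mult_unit[OF not_dvd_4])
  qed
  also have "\<dots> = (\<Sum>w\<in>P. \<Sum>r\<in>P. D (w ^ 2 - w * r + 1) * f r)"
    by (rule sum.swap)
  \<comment> \<open>With \<open>r = v + w\<close> the quadratic collapses to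
    \<open>1 - w * v\<close>.\<close>
  also have "\<dots> = (\<Sum>w\<in>P. \<Sum>v\<in>P. D (w ^ 2 - w * (1 * v + w) + 1) * f (1 * v + w))"
  proof (rule sum.cong[OF refl])
    fix w
    show "(\<Sum>r\<in>P. D (w ^ 2 - w * r + 1) * f r)
        = (\<Sum>v\<in>P. D (w ^ 2 - w * (1 * v + w) + 1) * f (1 * v + w))"
      using gt_2 by (intro sum_affine[symmetric] periodicity f) auto
  qed
  finally show ?thesis
    by (simp add: power2_eq_square algebra_simps)
qed

definition T :: complex where
  "T = (\<Sum>x\<in>P. \<Sum>y\<in>P. (\<chi> x * \<chi> (1 - x)) * (\<chi> y * \<chi> (1 - y)) * \<chi> (x - y))"

text \<open>The map \<open>r = 4 * x - 2\<close> carries 0 and 1 to the zeros -2 and 2 of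
  \<open>r ^ 2 - 4\<close>. Only powers of 4 and signs come out, and \<open>\<chi>\<close> is 1 on
  both.\<close>

lemma T_symmetric: "(\<Sum>r\<in>P. \<Sum>q\<in>P. \<chi> (r ^ 2 - 4) * \<chi> (q ^ 2 - 4) * \<chi> (r - q)) = T"
proof -
  let ?A = "\<lambda>r q. \<chi> (r ^ 2 - 4) * \<chi> (q ^ 2 - 4) * \<chi> (r - q)"
  have "(\<Sum>r\<in>P. \<Sum>q\<in>P. ?A r q) = (\<Sum>x\<in>P. \<Sum>q\<in>P. ?A (4 * x + (-2)) q)"
    by (rule sum_affine[symmetric, OF _ not_dvd_4]) (intro periodicity)
  also have "\<dots> = (\<Sum>x\<in>P. \<Sum>y\<in>P. ?A (4 * x + (-2)) (4 * y + (-2)))"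
    by (rule sum.cong[OF refl], rule sum_affine[symmetric, OF _ not_dvd_4]) (intro periodicity)
  also have "\<dots> = T"
    unfolding T_def
  proof (intro sum.cong refl)
    fix x y
    have sq: "(4 * x + (-2)) ^ 2 - 4 = 4 * (4 * (x * - (1 - x)))" for x :: int
      by (simp add: power2_eq_square algebra_simps)
    have diff: "4 * x + (-2) - (4 * y + (-2)) = 4 * (x - y)" for x y :: int by simp
    show "?A (4 * x + (-2)) (4 * y + (-2)) = (\<chi> x * \<chi> (1 - x)) * (\<chi> y * \<chi> (1 - y)) * \<chi> (x - y)"
      unfolding sq diff chi_mult chi_4 chi_minus by simp
  qed
  finally show ?thesis .
qed

text \<open>Let \<open>v\<close> be the inverse of \<open>w\<close>. Then \<open>\<chi> w\<close>
  may be replaced by \<open>\<chi> v\<close>, and \<open>v * (1 - w * s) * (1 - w * t)\<close>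
  reduces to \<open>w + v - (s + t)\<close> when \<open>s * t = 1\<close>. If \<open>w = 0\<close>,
  both sides vanish.\<close>

lemma hyperbola_product:
  "D (1 - s * t) * (\<chi> w * \<chi> (1 - w * s) * \<chi> (1 - w * t))
    = (\<Sum>v\<in>P. D (1 - w * v) * (D (1 - s * t) * \<chi> (w + v - (s + t))))"
proof -
  let ?e = "D (1 - s * t) * (\<chi> w * \<chi> (1 - w * s) * \<chi> (1 - w * t))"
  have "?e = (\<Sum>v\<in>P. D (1 - v * w)) * ?e"
    unfolding sum_D_hyperbola by (auto simp: D_def chi_eq_0_iff)
  also have "\<dots> = (\<Sum>v\<in>P. D (1 - w * v) * (D (1 - s * t) * \<chi> (w + v - (s + t))))"
    unfolding sum_distrib_right
  proof (intro sum.cong refl)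
    fix v
    show "D (1 - v * w) * ?e = D (1 - w * v) * (D (1 - s * t) * \<chi> (w + v - (s + t)))"
    proof (cases "int p dvd 1 - v * w \<and> int p dvd 1 - s * t")
      case True
      \<comment> \<open>The difference as an exact combination of \<open>1 - v * w\<close> and
        \<open>1 - s * t\<close>.\<close>
      have "v * (1 - w * s) * (1 - w * t) - (w + v - (s + t))
          = (1 - v * w) * (s + t - w) - (1 - s * t) * (v * w * w)"
        by (simp add: algebra_simps)
      moreover have "int p dvd \<dots>" using True by simp
      ultimately have "[v * (1 - w * s) * (1 - w * t) = w + v - (s + t)] (mod int p)"
        by (simp only: cong_iff_dvd_diff)
      then have "\<chi> (v * (1 - w * s) * (1 - w * t)) = \<chi> (w + v - (s + t))"
        by (rule periodicD[OF chi_periodic])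
      moreover have "\<chi> v = \<chi> w"
        using hyperbola_chi[of v w] True by (simp add: D_def)
      ultimately show ?thesis by (simp add: chi_mult mult.commute[of w v])
    qed (auto simp: D_def mult.commute[of w v])
  qed
  finally show ?thesis .
qed

lemma jacobi_square_plus_cnj: "jacobi_sum p \<psi> \<chi> ^ 2 + cnj (jacobi_sum p \<psi> \<chi>) ^ 2 = T"
proof -
  let ?A = "\<lambda>r. \<chi> (r ^ 2 - 4)"
  \<comment> \<open>Conjugation affects only \<open>\<psi>\<close>, since \<open>\<chi>\<close> is
    real, and the two values of \<open>\<psi>\<close> merge into one at
    \<open>u * v\<close>.\<close>
  have "jacobi_sum p \<psi> \<chi> ^ 2 + cnj (jacobi_sum p \<psi> \<chi>) ^ 2
      = (\<Sum>u\<in>P. \<Sum>v\<in>P. (\<psi> (u * v) + cnj (\<psi> (u * v))) * (\<chi> (1 - u) * \<chi> (1 - v)))"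
    by (simp add: jacobi_sum_def power2_eq_square sum_product psi_mult algebra_simps sum.distrib)
  also have "\<dots> = (\<Sum>u\<in>P. \<Sum>v\<in>P. \<Sum>w\<in>P. D (w ^ 2 - u * v) * \<chi> w * (\<chi> (1 - u) * \<chi> (1 - v)))"
    by (simp only: psi_plus_cnj sum_distrib_right)
  also have "\<dots> = (\<Sum>u\<in>P. \<Sum>w\<in>P. \<Sum>v\<in>P. D (w ^ 2 - u * v) * \<chi> w * (\<chi> (1 - u) * \<chi> (1 - v)))"
    by (rule sum.cong[OF refl], rule sum.swap)
  also have "\<dots> = (\<Sum>w\<in>P. \<Sum>u\<in>P. \<Sum>v\<in>P. D (w ^ 2 - u * v) * \<chi> w * (\<chi> (1 - u) * \<chi> (1 - v)))"
    by (rule sum.swap)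
  \<comment> \<open>The substitution \<open>u = w * s\<close>, \<open>v = w * t\<close> turns
    \<open>w ^ 2 = u * v\<close> into \<open>s * t = 1\<close>; for \<open>w = 0\<close> the factor
    \<open>\<chi> w\<close> removes both sides.\<close>
  also have "\<dots> = (\<Sum>w\<in>P. \<Sum>s\<in>P. \<Sum>t\<in>P. D (1 - s * t) * (\<chi> w * \<chi> (1 - w * s) * \<chi> (1 - w * t)))"
  proof (rule sum.cong[OF refl])
    fix w
    let ?B = "\<lambda>u v. D (w ^ 2 - u * v) * \<chi> w * (\<chi> (1 - u) * \<chi> (1 - v))"
    show "(\<Sum>u\<in>P. \<Sum>v\<in>P. ?B u v)
        = (\<Sum>s\<in>P. \<Sum>t\<in>P. D (1 - s * t) * (\<chi> w * \<chi> (1 - w * s) * \<chi> (1 - w * t)))"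
    proof (cases "int p dvd w")
      case False
      have "(\<Sum>u\<in>P. \<Sum>v\<in>P. ?B u v) = (\<Sum>s\<in>P. \<Sum>v\<in>P. ?B (w * s + 0) v)"
        by (rule sum_affine[symmetric, OF _ False]) (intro periodicity)
      also have "\<dots> = (\<Sum>s\<in>P. \<Sum>t\<in>P. ?B (w * s + 0) (w * t + 0))"
        by (rule sum.cong[OF refl], rule sum_affine[symmetric, OF _ False]) (intro periodicity)
      also have "\<dots> = (\<Sum>s\<in>P. \<Sum>t\<in>P. D (1 - s * t) * (\<chi> w * \<chi> (1 - w * s) * \<chi> (1 - w * t)))"
      proof (intro sum.cong refl)
        fix s t
        have "w ^ 2 - (w * s + 0) * (w * t + 0) = w * (w * (1 - s * t))"
          by (simp add: power2_eq_square algebra_simps)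
        then have "D (w ^ 2 - (w * s + 0) * (w * t + 0)) = D (1 - s * t)"
          by (simp only: D_mult_unit[OF False])
        then show "?B (w * s + 0) (w * t + 0)
            = D (1 - s * t) * (\<chi> w * \<chi> (1 - w * s) * \<chi> (1 - w * t))"
          by (simp add: mult_ac)
      qed
      finally show ?thesis .
    qed (simp add: chi_eq_0_iff[THEN iffD2])
  qed
  also have "\<dots> = (\<Sum>w\<in>P. \<Sum>s\<in>P. \<Sum>v\<in>P. \<Sum>t\<in>P. D (1 - w * v) * (D (1 - s * t) * \<chi> (w + v - (s + t))))"
    unfolding hyperbola_product by (rule sum.cong[OF refl], rule sum.cong[OF refl], rule sum.swap)
  also have "\<dots> = (\<Sum>w\<in>P. \<Sum>v\<in>P. \<Sum>s\<in>P. \<Sum>t\<in>P. D (1 - w * v) * (D (1 - s * t) * \<chi> (w + v - (s + t))))"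
    by (rule sum.cong[OF refl], rule sum.swap)
  \<comment> \<open>The summand depends on \<open>s\<close> and \<open>t\<close> only through
    \<open>s + t\<close>, so the inner hyperbola becomes a sum over \<open>q\<close>; the next step
    treats \<open>w\<close> and \<open>v\<close> alike.\<close>
  also have "\<dots> = (\<Sum>w\<in>P. \<Sum>v\<in>P. D (1 - w * v) * (\<Sum>q\<in>P. (1 + ?A q) * \<chi> (w + v - q)))"
  proof (rule sum.cong[OF refl], rule sum.cong[OF refl])
    fix w v
    have "periodic p (\<lambda>q. \<chi> (w + v - q))" by (intro periodicity)
    from sum_hyperbola[OF this]
    show "(\<Sum>s\<in>P. \<Sum>t\<in>P. D (1 - w * v) * (D (1 - s * t) * \<chi> (w + v - (s + t))))
        = D (1 - w * v) * (\<Sum>q\<in>P. (1 + ?A q) * \<chi> (w + v - q))"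
      by (simp only: flip: sum_distrib_left)
  qed
  also have "\<dots> = (\<Sum>r\<in>P. (1 + ?A r) * (\<Sum>q\<in>P. (1 + ?A q) * \<chi> (r - q)))"
    by (rule sum_hyperbola) (intro periodicity)
  \<comment> \<open>In any term lacking one of the factors \<open>?A\<close>, the variable concerned
    occurs only in \<open>\<chi> (r - q)\<close>, whose complete sum is 0.\<close>
  also have "\<dots> = (\<Sum>r\<in>P. (\<Sum>q\<in>P. ?A q * \<chi> (r - q))) + (\<Sum>r\<in>P. \<Sum>q\<in>P. ?A r * ?A q * \<chi> (r - q))"
    by (simp add: distrib_right sum.distrib sum_chi_minus sum_distrib_left mult.assoc)
  also have "(\<Sum>r\<in>P. (\<Sum>q\<in>P. ?A q * \<chi> (r - q))) = 0"
    by (subst sum.swap) (simp add: sum_chi_minus flip: sum_distrib_left)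
  finally show ?thesis by (simp add: T_symmetric)
qed

section \<open>Common neighbours of 0 and 1\<close>

definition S :: "int \<Rightarrow> complex" where
  "S a = of_bool (\<chi> a = 1)"

text \<open>At 0 the average of 1 and \<open>\<chi> a\<close> would be 1/2; the delta corrects it to
  0.\<close>

lemma S_eq: "S a = (1 + \<chi> a - D a) / 2"
  by (cases a rule: chi_cases) (auto simp: S_def D_def)

lemma S_periodic: "periodic p S"
  using chi_periodic by (simp add: periodic_def S_def)

lemma S_minus_commute: "S (a - b) = S (b - a)"
  by (simp add: S_def chi_minus_commute)

text \<open>The indicator of the common neighbours of the adjacent vertices 0 and 1.\<close>

definition neighbour :: "int \<Rightarrow> complex" where
  "neighbour x = S x * S (1 - x)"

lemma chi_complement:
  "int p dvd x \<Longrightarrow> \<chi> (1 - x) = 1" "int p dvd 1 - x \<Longrightarrow> \<chi> x = 1"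
proof -
  show "\<chi> (1 - x) = 1" if "int p dvd x"
    using periodicD[OF chi_periodic, of "1 - x" 1] that by (simp add: cong_iff_dvd_diff)
  show "\<chi> x = 1" if "int p dvd 1 - x"
    using periodicD[OF chi_periodic, of 1 x] that by (simp add: cong_iff_dvd_diff)
qed

text \<open>The product of \<open>1 + \<chi> x\<close> and \<open>1 + \<chi> (1 - x)\<close> is
  right except at 0 and 1, where it equals 2 instead of 0.\<close>

lemma neighbour_eq:
  "4 * neighbour x = 1 + \<chi> x + \<chi> (1 - x) + \<chi> x * \<chi> (1 - x) - 2 * D x - 2 * D (1 - x)"
  using chi_complement[of x]
  by (cases x rule: chi_cases; cases "1 - x" rule: chi_cases)
     (auto simp: neighbour_def S_def D_def)

lemma neighbour_simps:
  "neighbour x * \<chi> x = neighbour x" "neighbour x * \<chi> (1 - x) = neighbour x"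
  "neighbour x * D x = 0" "neighbour x * D (1 - x) = 0" "neighbour x * neighbour x = neighbour x"
  by (auto simp: neighbour_def S_def D_def chi_eq_0_iff[symmetric])

lemma sum_neighbour: "(\<Sum>x\<in>P. neighbour x) = (of_nat p - 5) / 4"
proof -
  have D0: "(\<Sum>x\<in>P. D x) = 1" using sum_D_1[of 0] by simp
  have D1: "(\<Sum>x\<in>P. D (1 - x)) = 1" using sum_D_1[of 1] by (simp add: D_minus_commute)
  have "4 * (\<Sum>x\<in>P. neighbour x) = (\<Sum>x\<in>P. 4 * neighbour x)"
    by (rule sum_distrib_left)
  also have "\<dots> = of_nat p - 5"
    unfolding neighbour_eq sum.distrib sum_subtractf sum_chi_chi_1 sum_chi_minus sum_chi
      sum_distrib_left[symmetric] D0 D1 by simp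
  finally show ?thesis by (simp add: field_simps)
qed

lemma sum_D_complement: "periodic p f \<Longrightarrow> (\<Sum>x\<in>P. D (1 - x) * f x) = f 1"
  using sum_D[of f 1] by (simp add: D_minus_commute)

lemma sum_chi_complement_shift: "(\<Sum>x\<in>P. \<chi> (1 - x) * \<chi> (x - y)) = of_nat p * D (1 - y) - 1"
proof -
  have "(\<Sum>x\<in>P. \<chi> (1 - x) * \<chi> (x - y)) = (\<Sum>x\<in>P. \<chi> (1 - (-1 * x + 1)) * \<chi> ((-1 * x + 1) - y))"
    using gt_2 by (intro sum_affine[symmetric] periodicity) auto
  also have "\<dots> = (\<Sum>x\<in>P. \<chi> x * \<chi> (x - (1 - y)))"
    by (intro sum.cong refl) (subst chi_minus[symmetric, of "-1 * x + 1 - y"], simp add: algebra_simps)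
  finally show ?thesis by (simp only: sum_chi_chi_shift)
qed

text \<open>Expanding by \<open>neighbour_eq\<close>, every term but the one with
  \<open>\<chi> x * \<chi> (1 - x)\<close> has a closed form.\<close>

lemma sum_neighbour_chi_shift:
  "(\<Sum>x\<in>P. 4 * neighbour x * \<chi> (x - y)) = of_nat p * D y + of_nat p * D (1 - y) - 2
    + (\<Sum>x\<in>P. \<chi> x * \<chi> (1 - x) * \<chi> (x - y)) - 2 * \<chi> y - 2 * \<chi> (1 - y)"
proof -
  have per: "periodic p (\<lambda>x. \<chi> (x - y))" by (intro periodicity)
  have D0: "(\<Sum>x\<in>P. D x * \<chi> (x - y)) = \<chi> y" using sum_D[OF per, of 0] by simp
  show ?thesis
    unfolding neighbour_eq
    by (simp add: distrib_right left_diff_distrib sum.distrib sum_subtractf mult.assoc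
        sum_chi_minus sum_chi_chi_shift sum_chi_complement_shift D0 sum_D_complement[OF per]
        flip: sum_distrib_left)
qed

lemma sum_neighbour_neighbour_chi:
  "(\<Sum>y\<in>P. \<Sum>x\<in>P. (4 * neighbour x) * (4 * neighbour y) * \<chi> (x - y)) = T + 36 - 6 * of_nat p"
proof -
  define h where "h x = \<chi> x * \<chi> (1 - x)" for x
  let ?g = "\<lambda>x. 4 * neighbour x"
  let ?H = "\<lambda>y. \<Sum>x\<in>P. h x * \<chi> (x - y)"
  have A: "(\<Sum>x\<in>P. ?g x * \<chi> (x - y))
      = of_nat p * D y + of_nat p * D (1 - y) - 2 + ?H y - 2 * \<chi> y - 2 * \<chi> (1 - y)" for y
    unfolding sum_neighbour_chi_shift h_def ..
  have g: "(\<Sum>x\<in>P. ?g x) = of_nat p - 5"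
    by (simp add: sum_neighbour flip: sum_distrib_left)
  have "(\<Sum>y\<in>P. \<Sum>x\<in>P. ?g x * ?g y * \<chi> (x - y)) = (\<Sum>y\<in>P. ?g y * (\<Sum>x\<in>P. ?g x * \<chi> (x - y)))"
    by (simp add: sum_distrib_left mult_ac)
  \<comment> \<open>On the support of \<open>?g\<close> the deltas vanish and
    \<open>\<chi> y\<close> and \<open>\<chi> (1 - y)\<close> are 1, so three times -2
    remains.\<close>
  also have "\<dots> = (\<Sum>y\<in>P. ?g y * ?H y - 6 * ?g y)"
    unfolding A
  proof (rule sum.cong[OF refl])
    fix y
    let ?f = "neighbour y"
    have "?g y * (of_nat p * D y + of_nat p * D (1 - y) - 2 + ?H y - 2 * \<chi> y - 2 * \<chi> (1 - y))
        = 4 * (of_nat p * (?f * D y) + of_nat p * (?f * D (1 - y)) - 2 * ?f + ?f * ?H y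
            - 2 * (?f * \<chi> y) - 2 * (?f * \<chi> (1 - y)))"
      by (simp only: algebra_simps)
    then show "?g y * (of_nat p * D y + of_nat p * D (1 - y) - 2 + ?H y - 2 * \<chi> y - 2 * \<chi> (1 - y))
        = ?g y * ?H y - 6 * ?g y"
      by (simp add: neighbour_simps)
  qed
  also have "\<dots> = (\<Sum>y\<in>P. ?g y * ?H y) - 6 * (of_nat p - 5)"
    by (simp only: sum_subtractf g sum_distrib_left[symmetric, of 6])
  \<comment> \<open>Exchanging the sums exposes the second factor \<open>?g\<close> to the same
    expansion.\<close>
  also have "(\<Sum>y\<in>P. ?g y * ?H y) = (\<Sum>x\<in>P. h x * (\<Sum>y\<in>P. ?g y * \<chi> (y - x)))"
    unfolding sum_distrib_left by (subst sum.swap) (simp add: mult_ac chi_minus_commute)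
  also have "\<dots> = (\<Sum>x\<in>P. h x * ?H x - 2 * h x - 2 * (1 - D x) * \<chi> (1 - x) - 2 * \<chi> x * (1 - D (1 - x)))"
    unfolding A
  proof (intro sum.cong refl)
    fix x
    have "h x * D x = 0" "h x * D (1 - x) = 0"
      by (auto simp: h_def D_def chi_eq_0_iff)
    moreover have "h x * \<chi> x = (1 - D x) * \<chi> (1 - x)" "h x * \<chi> (1 - x) = \<chi> x * (1 - D (1 - x))"
      by (simp_all add: h_def flip: chi_mult_self)
    moreover have "h x * (of_nat p * D x + of_nat p * D (1 - x) - 2 + ?H x - 2 * \<chi> x - 2 * \<chi> (1 - x))
        = of_nat p * (h x * D x) + of_nat p * (h x * D (1 - x)) - 2 * h x + h x * ?H x
          - 2 * (h x * \<chi> x) - 2 * (h x * \<chi> (1 - x))"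
      by (simp only: algebra_simps)
    ultimately show "h x * (of_nat p * D x + of_nat p * D (1 - x) - 2 + ?H x - 2 * \<chi> x - 2 * \<chi> (1 - x))
        = h x * ?H x - 2 * h x - 2 * (1 - D x) * \<chi> (1 - x) - 2 * \<chi> x * (1 - D (1 - x))"
      by (simp only:) simp
  qed
  also have "\<dots> = (\<Sum>x\<in>P. h x * ?H x) - 2 * (\<Sum>x\<in>P. h x)
      - 2 * ((\<Sum>x\<in>P. \<chi> (1 - x)) - (\<Sum>x\<in>P. D x * \<chi> (1 - x)))
      - 2 * ((\<Sum>x\<in>P. \<chi> x) - (\<Sum>x\<in>P. D (1 - x) * \<chi> x))"
    unfolding sum_distrib_left sum_subtractf[symmetric]
    by (rule sum.cong[OF refl]) (simp add: algebra_simps)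
  also have "(\<Sum>x\<in>P. h x) = -1"
    unfolding h_def by (rule sum_chi_chi_1)
  also have "(\<Sum>x\<in>P. D x * \<chi> (1 - x)) = 1"
    using sum_D[of "\<lambda>x. \<chi> (1 - x)" 0] by (simp add: periodicity)
  also have "(\<Sum>x\<in>P. D (1 - x) * \<chi> x) = 1"
    using sum_D_complement[OF chi_periodic] by simp
  also have "(\<Sum>x\<in>P. h x * ?H x) = T"
    unfolding T_def h_def sum_distrib_left
    by (intro sum.cong refl) (simp add: chi_minus_commute mult_ac)
  \<comment> \<open>The last sums contribute 2 each, so the total is
    \<open>T + 6 - 6 * (p - 5)\<close>.\<close>
  finally show ?thesis
    by (simp add: sum_chi sum_chi_minus)
qed

text \<open>By \<open>S_eq\<close>, twice the sum is the squared number of neighbours plus the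
  \<open>\<chi>\<close> sum minus the diagonal. Over 16, the parts free of \<open>T\<close> are
  \<open>(p - 5) ^ 2 + 36 - 6 * p - 4 * (p - 5)\<close>, which is
  \<open>(p - 9) ^ 2 - 2 * p\<close>.\<close>

lemma sum_common_neighbours:
  "(\<Sum>y\<in>P. \<Sum>x\<in>P. neighbour x * neighbour y * S (x - y)) = ((of_nat p - 9) ^ 2 - 2 * of_nat p + T) / 32"
proof -
  let ?f = neighbour
  have per: "periodic p ?f"
    unfolding neighbour_def by (intro periodicity periodic_compose[OF S_periodic])
  have D: "(\<Sum>x\<in>P. ?f x * ?f y * D (x - y)) = ?f y" for y
  proof -
    have "(\<Sum>x\<in>P. ?f x * ?f y * D (x - y)) = ?f y * (\<Sum>x\<in>P. D (x - y) * ?f x)"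
      by (simp add: sum_distrib_left mult_ac)
    then show ?thesis by (simp add: sum_D[OF per] neighbour_simps)
  qed
  have chi: "(\<Sum>y\<in>P. \<Sum>x\<in>P. ?f x * ?f y * \<chi> (x - y)) = (T + 36 - 6 * of_nat p) / 16"
  proof -
    have "16 * (\<Sum>y\<in>P. \<Sum>x\<in>P. ?f x * ?f y * \<chi> (x - y)) = T + 36 - 6 * of_nat p"
      unfolding sum_neighbour_neighbour_chi[symmetric] sum_distrib_left by (simp add: mult_ac)
    then show ?thesis by (simp add: mult.commute[of _ 16])
  qed
  have "2 * (\<Sum>y\<in>P. \<Sum>x\<in>P. ?f x * ?f y * S (x - y))
      = (\<Sum>y\<in>P. \<Sum>x\<in>P. ?f x * ?f y) + (\<Sum>y\<in>P. \<Sum>x\<in>P. ?f x * ?f y * \<chi> (x - y))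
        - (\<Sum>y\<in>P. \<Sum>x\<in>P. ?f x * ?f y * D (x - y))"
    unfolding S_eq sum_distrib_left sum.distrib[symmetric] sum_subtractf[symmetric]
    by (intro sum.cong refl) (simp add: field_simps)
  also have "(\<Sum>y\<in>P. \<Sum>x\<in>P. ?f x * ?f y) = (\<Sum>x\<in>P. ?f x) * (\<Sum>x\<in>P. ?f x)"
    by (simp add: sum_product mult.commute)
  also have "\<dots> + (\<Sum>y\<in>P. \<Sum>x\<in>P. ?f x * ?f y * \<chi> (x - y)) - (\<Sum>y\<in>P. \<Sum>x\<in>P. ?f x * ?f y * D (x - y))
      = 2 * (((of_nat p - 9) ^ 2 - 2 * of_nat p + T) / 32)"
    unfolding D chi sum_neighbour by (simp add: field_simps power2_eq_square)
  finally show ?thesis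
    unfolding mult_cancel_left by simp
qed

section \<open>Ordered cliques modulo a prime\<close>

text \<open>Since \<open>S\<close> vanishes at 0, tuples with a repeated vertex count 0.\<close>

definition clique :: "int \<Rightarrow> int \<Rightarrow> int \<Rightarrow> int \<Rightarrow> complex" where
  "clique d a b c = S (d - a) * S (d - b) * S (d - c) * S (a - b) * S (a - c) * S (b - c)"

lemma clique_periodic: "periodic p (clique d a b)" "periodic p (\<lambda>b. clique d a b c)"
   "periodic p (\<lambda>a. clique d a b c)" "periodic p (\<lambda>d. clique d a b c)"
  unfolding clique_def by (intro periodicity periodic_compose[OF S_periodic])+

lemma sum_S: "(\<Sum>a\<in>P. S a) = (of_nat p - 1) / 2"
  using sum_D_1[of 0]
  by (simp add: S_eq sum.distrib sum_subtractf sum_chi flip: sum_divide_distrib)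

text \<open>Translation moves \<open>d\<close> to 0, giving a factor \<open>p\<close>; then the
  neighbour \<open>a\<close> of 0 can be chosen in \<open>(p - 1) / 2\<close> ways, and division by
  \<open>a\<close> moves it to 1.\<close>

lemma sum_cliques:
  "(\<Sum>d\<in>P. \<Sum>a\<in>P. \<Sum>b\<in>P. \<Sum>c\<in>P. clique d a b c)
    = of_nat p * (of_nat p - 1) * ((of_nat p - 9) ^ 2 - 2 * of_nat p + T) / 64"
proof -
  let ?N = "(\<Sum>y\<in>P. \<Sum>x\<in>P. neighbour x * neighbour y * S (x - y))"
  have unit: "\<not> int p dvd 1" using gt_2 by auto
  note shift = sum_affine[OF _ unit, unfolded mult_1_left, symmetric]
  have inner: "(\<Sum>a\<in>P. \<Sum>b\<in>P. \<Sum>c\<in>P. clique d a b c) = (of_nat p - 1) / 2 * ?N" for d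
  proof -
    have "(\<Sum>a\<in>P. \<Sum>b\<in>P. \<Sum>c\<in>P. clique d a b c) = (\<Sum>a\<in>P. \<Sum>b\<in>P. \<Sum>c\<in>P. clique d (a + d) b c)"
      by (rule shift) (intro periodicity clique_periodic)
    also have "\<dots> = (\<Sum>a\<in>P. \<Sum>b\<in>P. \<Sum>c\<in>P. clique d (a + d) (b + d) c)"
      by (rule sum.cong[OF refl], rule shift) (intro periodicity clique_periodic)
    also have "\<dots> = (\<Sum>a\<in>P. \<Sum>b\<in>P. \<Sum>c\<in>P. clique d (a + d) (b + d) (c + d))"
      by (rule sum.cong[OF refl], rule sum.cong[OF refl], rule shift) (intro periodicity clique_periodic)
    also have "\<dots> = (\<Sum>a\<in>P. \<Sum>b\<in>P. \<Sum>c\<in>P. clique 0 a b c)"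
      by (simp add: clique_def)
    also have "\<dots> = (\<Sum>a\<in>P. S a * ?N)"
    proof (rule sum.cong[OF refl])
      fix a
      show "(\<Sum>b\<in>P. \<Sum>c\<in>P. clique 0 a b c) = S a * ?N"
      proof (cases "int p dvd a")
        case True
        then have "S a = 0" by (simp add: S_def chi_eq_0_iff[THEN iffD2])
        then show ?thesis using S_minus_commute[of 0 a] by (simp add: clique_def)
      next
        case False
        have "(\<Sum>b\<in>P. \<Sum>c\<in>P. clique 0 a b c) = (\<Sum>y\<in>P. \<Sum>c\<in>P. clique 0 a (a * y + 0) c)"
          by (rule sum_affine[symmetric, OF _ False]) (intro periodicity clique_periodic)
        also have "\<dots> = (\<Sum>y\<in>P. \<Sum>x\<in>P. clique 0 a (a * y + 0) (a * x + 0))"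
          by (rule sum.cong[OF refl], rule sum_affine[symmetric, OF _ False]) (intro periodicity clique_periodic)
        also have "\<dots> = S a * ?N"
          unfolding sum_distrib_left
        proof (intro sum.cong refl)
          fix x y
          have minus: "S (0 - x) = S x" for x using S_minus_commute[of 0 x] by simp
          have fact: "a - (a * x + 0) = a * (1 - x)" "a * y + 0 - (a * x + 0) = a * (y - x)" for x y
            by (simp_all add: algebra_simps)
          \<comment> \<open>If \<open>S a = 0\<close>, both sides vanish; otherwise
            \<open>\<chi> a = 1\<close> and the factor \<open>a\<close> drops out of every
            argument.\<close>
          show "clique 0 a (a * y + 0) (a * x + 0) = S a * (neighbour x * neighbour y * S (x - y))"
            unfolding clique_def minus fact neighbour_def
            by (auto simp: S_def chi_mult chi_minus_commute)
        qed
        finally show ?thesis .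
      qed
    qed
    also have "\<dots> = (of_nat p - 1) / 2 * ?N"
      by (simp only: sum_S flip: sum_distrib_right)
    finally show ?thesis .
  qed
  show ?thesis
    unfolding inner sum_common_neighbours by simp
qed

end

section \<open>Characters modulo a prime power\<close>

lemma dirichlet_character_cong:
  "dirichlet_character n \<chi> \<Longrightarrow> [a = b] (mod int n) \<Longrightarrow> \<chi> a = \<chi> b"
  by (simp add: dirichlet_character_def)

lemma dirichlet_character_power:
  assumes "dirichlet_character n \<chi>"
  shows "\<chi> (a ^ k) = \<chi> a ^ k"
  using assms by (induction k) (simp_all add: dirichlet_character_def)

lemma euler_theorem_int:
  assumes "coprime a (int n)" "n > 0"
  shows "[a ^ totient n = 1] (mod int n)"
proof -
  define b where "b = nat (a mod int n)"
  have b: "int b = a mod int n" using assms by (simp add: b_def)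
  have "coprime (int b) (int n)" using assms by (simp add: b)
  then have "[b ^ totient n = 1] (mod n)" by (intro euler_theorem) simp
  then have "[int b ^ totient n = 1] (mod int n)"
    by (metis cong_int_iff of_nat_1 of_nat_power)
  moreover have "[a ^ totient n = int b ^ totient n] (mod int n)"
    unfolding b by (intro cong_pow) simp
  ultimately show ?thesis using cong_trans by blast
qed

text \<open>Euler's theorem makes \<open>totient n\<close> an admissible exponent, so the least one
  exists.\<close>

lemma character_order_power:
  assumes "dirichlet_character n \<chi>" "n > 0" "coprime a (int n)"
  shows "\<chi> a ^ character_order n \<chi> = 1"
proof -
  let ?Q = "\<lambda>k. k > 0 \<and> (\<forall>a. coprime a (int n) \<longrightarrow> \<chi> a ^ k = 1)"
  have "?Q (totient n)"
  proof safe
    fix a assume "coprime a (int n)"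
    with assms have "\<chi> (a ^ totient n) = \<chi> 1"
      by (intro dirichlet_character_cong[of n] euler_theorem_int)
    with assms show "\<chi> a ^ totient n = 1"
      by (simp add: dirichlet_character_power[of n] dirichlet_character_def)
  qed (use assms in auto)
  then have "?Q (character_order n \<chi>)"
    unfolding character_order_def by (rule LeastI)
  with assms show ?thesis by blast
qed

lemma character_order_minimal:
  assumes "0 < k" "k < character_order n \<chi>"
  obtains a where "coprime a (int n)" "\<chi> a ^ k \<noteq> 1"
  using not_less_Least[OF assms(2)[unfolded character_order_def]] assms(1) by blast

section \<open>Descent from a prime power to the prime\<close>

text \<open>Each \<open>p\<close>-th power gains a factor \<open>p\<close>: in
  \<open>x ^ p - y ^ p\<close> the cofactor of \<open>x - y\<close> has \<open>p\<close> terms, all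
  congruent to \<open>y ^ (p - 1)\<close> modulo \<open>p\<close>.\<close>

lemma cong_prime_power_lift:
  fixes a b :: int
  assumes "[a = b] (mod int p)"
  shows "[a ^ (p ^ k) = b ^ (p ^ k)] (mod int (p ^ Suc k))"
proof (induction k)
  case (Suc k)
  define x y where "x = a ^ (p ^ k)" and "y = b ^ (p ^ k)"
  have xy: "int (p ^ Suc k) dvd x - y"
    using Suc.IH by (simp add: x_def y_def cong_iff_dvd_diff)
  then have "[x = y] (mod int p)"
    by (simp add: cong_iff_dvd_diff) (meson dvd_trans dvd_triv_left)
  then have "[(\<Sum>i<p. y ^ (p - Suc i) * x ^ i) = (\<Sum>i<p. y ^ (p - Suc i) * y ^ i)] (mod int p)"
    by (intro cong_sum cong_mult cong_pow cong_refl)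
  also have "(\<Sum>i<p. y ^ (p - Suc i) * y ^ i) = (\<Sum>i<p. y ^ (p - 1))"
    by (intro sum.cong refl) (simp flip: power_add)
  also have "[\<dots> = 0] (mod int p)"
    by (simp add: cong_0_iff)
  finally have "int p dvd (\<Sum>i<p. y ^ (p - Suc i) * x ^ i)"
    by (simp add: cong_0_iff)
  with xy have "int (p ^ Suc k) * int p dvd (x - y) * (\<Sum>i<p. y ^ (p - Suc i) * x ^ i)"
    by (rule mult_dvd_mono)
  then have "int (p ^ Suc (Suc k)) dvd x ^ p - y ^ p"
    by (simp add: power_diff_sumr2 mult_ac)
  then show ?case
    by (simp add: x_def y_def cong_iff_dvd_diff mult.commute flip: power_mult)
qed (use assms in simp)

text \<open>Since \<open>p \<equiv> 1 (mod 4)\<close>, raising to the power \<open>p ^ (\<alpha> - 1)\<close> fixes every value of a character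
  whose order divides 4, while it maps congruence modulo \<open>p\<close> to congruence modulo \<open>p ^ \<alpha>\<close>.\<close>

lemma dirichlet_character_prime_power_reduce:
  assumes p: "[p = 1] (mod 4)" and "\<alpha> > 0"
    and \<chi>: "dirichlet_character (p ^ \<alpha>) \<chi>"
    and quartic: "\<And>a. coprime a (int (p ^ \<alpha>)) \<Longrightarrow> \<chi> a ^ 4 = 1"
  shows "dirichlet_character p \<chi>"
proof -
  define q where "q = p ^ (\<alpha> - 1)"
  have "[q = 1 ^ (\<alpha> - 1)] (mod 4)" unfolding q_def by (intro cong_pow p)
  then have "q mod 4 = 1" by (simp add: cong_def)
  then obtain k where k: "q = 4 * k + 1" by (metis mult_div_mod_eq)
  have coprime: "coprime a (int (p ^ \<alpha>)) \<longleftrightarrow> coprime a (int p)" for a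
    using \<open>\<alpha> > 0\<close> by simp
  have fixed: "\<chi> (a ^ q) = \<chi> a" for a
  proof (cases "coprime a (int (p ^ \<alpha>))")
    case True
    then show ?thesis
      unfolding dirichlet_character_power[OF \<chi>] by (simp add: k power_mult quartic)
  next
    case False
    with \<chi> have "\<chi> a = 0" by (auto simp: dirichlet_character_def)
    then show ?thesis unfolding dirichlet_character_power[OF \<chi>] by (simp add: k)
  qed
  have "\<chi> a = \<chi> b" if "[a = b] (mod int p)" for a b
  proof -
    have "[a ^ q = b ^ q] (mod int (p ^ \<alpha>))"
      using cong_prime_power_lift[OF that, of "\<alpha> - 1"] \<open>\<alpha> > 0\<close> by (simp add: q_def)
    from dirichlet_character_cong[OF \<chi> this] show ?thesis by (simp add: fixed)
  qed
  with \<chi> show ?thesis using \<open>\<alpha> > 0\<close> by (simp add: dirichlet_character_def)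
qed

section \<open>Character values from a primitive root\<close>

lemma primitive_root_prime_power:
  assumes "prime p" "odd p" "\<alpha> > 0"
  obtains g :: int where "coprime g (int (p ^ \<alpha>))"
    "\<And>a. coprime a (int (p ^ \<alpha>)) \<Longrightarrow> \<exists>k. [a = g ^ k] (mod int (p ^ \<alpha>))"
proof -
  let ?n = "p ^ \<alpha>"
  have n: "?n > 1" using assms prime_gt_1_nat[of p] by (intro one_less_power)
  obtain g where g: "residue_primroot ?n g"
    using residue_primroot_odd_prime_power_exists[OF assms(1,2)] \<open>\<alpha> > 0\<close> by metis
  have "\<exists>k. [a = int g ^ k] (mod int ?n)" if a: "coprime a (int ?n)" for a
  proof -
    define b where "b = nat (a mod int ?n)"
    have b: "int b = a mod int ?n"
      unfolding b_def using n by (intro nat_0_le pos_mod_sign) linarith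
    have "coprime (int b) (int ?n)" unfolding b using a n by (simp only: coprime_mod_left_iff)
    then have "coprime b ?n" by (simp only: coprime_int_iff)
    moreover have "b < ?n" using b n by (metis pos_mod_bound of_nat_0_less_iff of_nat_less_iff less_trans zero_less_one)
    moreover have "b > 0" using calculation n by (cases "b = 0") auto
    ultimately have "b \<in> totatives ?n" by (simp add: totatives_def)
    then obtain k where "b = g ^ k mod ?n"
      using residue_primroot_is_generator[OF n g] by (auto simp: bij_betw_def)
    then have "int b = int g ^ k mod int ?n" by (metis of_nat_mod of_nat_power)
    then show ?thesis unfolding b by (auto simp: cong_def)
  qed
  moreover have "coprime (int g) (int ?n)"
    using g by (simp add: residue_primroot_def coprime_commute del: of_nat_power)
  ultimately show thesis using that by blast
qed

text \<open>A character is determined by its value at a primitive root \<open>g\<close>. Minimality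
  of the orders excludes \<open>\<chi> g = 1\<close> and \<open>\<psi> g ^ 2 = 1\<close>, leaving -1
  in both cases; everything else is the parity of an exponent of \<open>g\<close>.\<close>

lemma quadratic_character_values:
  assumes "prime p" "odd p" "\<alpha> > 0"
    and \<chi>: "dirichlet_character (p ^ \<alpha>) \<chi>" "character_order (p ^ \<alpha>) \<chi> = 2"
    and \<psi>: "dirichlet_character (p ^ \<alpha>) \<psi>" "character_order (p ^ \<alpha>) \<psi> = 4"
  shows "\<psi> a ^ 2 = \<chi> a"
    and "coprime a (int p) \<Longrightarrow> \<chi> a = 1 \<or> \<chi> a = -1"
    and "\<chi> a = 1 \<longleftrightarrow> (\<exists>x. coprime x (int (p ^ \<alpha>)) \<and> [a = x ^ 2] (mod int (p ^ \<alpha>)))"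
    and "\<exists>g. \<chi> g = -1"
proof -
  let ?n = "p ^ \<alpha>"
  have n: "?n > 0" using assms prime_gt_0_nat[of p] by simp
  obtain g where g: "coprime g (int ?n)"
    and gen: "\<And>a. coprime a (int ?n) \<Longrightarrow> \<exists>k. [a = g ^ k] (mod int ?n)"
    using primitive_root_prime_power[OF assms(1-3)] by metis
  have chi_gen: "\<chi> a = \<chi> g ^ k" and psi_gen: "\<psi> a = \<psi> g ^ k" if "[a = g ^ k] (mod int ?n)" for a k
    using dirichlet_character_cong[OF \<chi>(1) that] dirichlet_character_cong[OF \<psi>(1) that]
    by (simp_all add: dirichlet_character_power[OF \<chi>(1)] dirichlet_character_power[OF \<psi>(1)])
  have chi_g: "\<chi> g = -1"
  proof -
    obtain a where a: "coprime a (int ?n)" "\<chi> a ^ 1 \<noteq> 1"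
      using character_order_minimal[of 1 ?n \<chi>] \<chi>(2) by auto
    obtain k where "[a = g ^ k] (mod int ?n)" using gen[OF a(1)] by blast
    with a chi_gen have "\<chi> g \<noteq> 1" by auto
    with character_order_power[OF \<chi>(1) n g] show ?thesis
      by (auto simp: \<chi>(2) power2_eq_1_iff)
  qed
  have psi_g: "\<psi> g ^ 2 = -1"
  proof -
    obtain a where a: "coprime a (int ?n)" "\<psi> a ^ 2 \<noteq> 1"
      using character_order_minimal[of 2 ?n \<psi>] \<psi>(2) by auto
    obtain k where "[a = g ^ k] (mod int ?n)" using gen[OF a(1)] by blast
    with a psi_gen have "(\<psi> g ^ k) ^ 2 \<noteq> 1" by auto
    then have "\<psi> g ^ 2 \<noteq> 1" by (metis power_mult mult.commute power_one)
    moreover have "(\<psi> g ^ 2) ^ 2 = 1"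
      using character_order_power[OF \<psi>(1) n g] by (simp add: \<psi>(2))
    ultimately show ?thesis unfolding power2_eq_1_iff[of "\<psi> g ^ 2"] by blast
  qed
  show "\<psi> a ^ 2 = \<chi> a" for a
  proof (cases "coprime a (int ?n)")
    case True
    then obtain k where k: "[a = g ^ k] (mod int ?n)" using gen by blast
    have "\<psi> a ^ 2 = (\<psi> g ^ 2) ^ k"
      unfolding psi_gen[OF k] by (simp flip: power_mult add: mult.commute)
    then show ?thesis by (simp add: psi_g chi_g chi_gen[OF k])
  next
    case False
    with \<chi>(1) \<psi>(1) have "\<chi> a = 0" "\<psi> a = 0"
      unfolding dirichlet_character_def by blast+
    then show ?thesis by simp
  qed
  show "\<chi> a = 1 \<or> \<chi> a = -1" if "coprime a (int p)"
  proof -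
    have "coprime a (int ?n)" using that by simp
    then obtain k where k: "[a = g ^ k] (mod int ?n)" using gen by blast
    show ?thesis unfolding chi_gen[OF k] chi_g by (cases "even k") auto
  qed
  show "\<chi> a = 1 \<longleftrightarrow> (\<exists>x. coprime x (int ?n) \<and> [a = x ^ 2] (mod int ?n))"
  proof
    assume a: "\<chi> a = 1"
    then have "coprime a (int ?n)"
      using \<chi>(1) unfolding dirichlet_character_def by (metis zero_neq_one)
    then obtain k where k: "[a = g ^ k] (mod int ?n)" using gen by blast
    have "even k"
      using a unfolding chi_gen[OF k] chi_g by (cases "even k") auto
    then obtain j where "k = j * 2" by (metis evenE mult.commute)
    with k have "[a = (g ^ j) ^ 2] (mod int ?n)" by (simp add: power_mult)
    moreover have "coprime (g ^ j) (int ?n)" using g by (rule coprime_power_left_iff[THEN iffD2, OF disjI1])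
    ultimately show "\<exists>x. coprime x (int ?n) \<and> [a = x ^ 2] (mod int ?n)" by blast
  next
    assume "\<exists>x. coprime x (int ?n) \<and> [a = x ^ 2] (mod int ?n)"
    then obtain x where "coprime x (int ?n)" "[a = x ^ 2] (mod int ?n)" by blast
    then show "\<chi> a = 1"
      using character_order_power[OF \<chi>(1) n] dirichlet_character_cong[OF \<chi>(1)]
      by (metis \<chi>(2) dirichlet_character_power[OF \<chi>(1)])
  qed
  show "\<exists>g. \<chi> g = -1" using chi_g by blast
qed

lemma quartic_character_prime_power:
  assumes p: "prime p" "[p = 1] (mod 4)" "\<alpha> > 0"
    and \<chi>: "dirichlet_character (p ^ \<alpha>) \<chi>" "character_order (p ^ \<alpha>) \<chi> = 2"
    and \<psi>: "dirichlet_character (p ^ \<alpha>) \<psi>" "character_order (p ^ \<alpha>) \<psi> = 4"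
  shows "quartic_character p \<chi> \<psi>"
proof -
  have "p mod 4 = 1" using p by (simp add: cong_def)
  then have "odd p" by presburger
  have n: "p ^ \<alpha> > 0" using p prime_gt_0_nat[of p] by simp
  note quadratic = quadratic_character_values[OF p(1) \<open>odd p\<close> p(3) \<chi> \<psi>]
  have "dirichlet_character p \<chi>"
  proof (rule dirichlet_character_prime_power_reduce[OF p(2,3) \<chi>(1)])
    fix a assume "coprime a (int (p ^ \<alpha>))"
    from character_order_power[OF \<chi>(1) n this] have "(\<chi> a ^ 2) ^ 2 = 1" by (simp add: \<chi>(2))
    then show "\<chi> a ^ 4 = 1" by (simp flip: power_mult)
  qed
  moreover have "dirichlet_character p \<psi>"
    using dirichlet_character_prime_power_reduce[OF p(2,3) \<psi>(1)] character_order_power[OF \<psi>(1) n]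
    by (simp add: \<psi>(2))
  moreover have "\<exists>x. [a = x ^ 2] (mod int p)" if "\<chi> a = 1" for a
  proof -
    from that quadratic(3) obtain x where "[a = x ^ 2] (mod int (p ^ \<alpha>))" by blast
    then have "[a = x ^ 2] (mod int p)"
      by (rule cong_dvd_modulus) (use p(3) in simp)
    then show ?thesis ..
  qed
  moreover have "p > 2"
    using \<open>odd p\<close> prime_ge_2_nat[OF p(1)] by (cases "p = 2") auto
  ultimately show ?thesis
    using p(1) quadratic by unfold_locales auto
qed

section \<open>Cliques\<close>

text \<open>A subgraph inherits \<open>tail\<close> and \<open>head\<close> from \<open>G\<close>,
  so arcs are pairs of vertices and a complete subgraph is determined by its vertex set;
  \<open>?K\<close> rebuilds it.\<close>

lemma num_complete_subgraphs_eq_card_cliques: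
  fixes G :: "('a, 'a \<times> 'a) pre_digraph"
  assumes "wf_digraph G" "finite (verts G)" "tail G = fst" "head G = snd"
  shows "num_complete_subgraphs m G =
    card {W. W \<subseteq> verts G \<and> card W = m \<and> (\<forall>a\<in>W. \<forall>b\<in>W. a \<noteq> b \<longrightarrow> (a, b) \<in> arcs G)}"
    (is "_ = card ?C")
proof -
  let ?H = "{H. subgraph H G \<and> complete_digraph m H}"
  let ?K = "\<lambda>W. \<lparr>verts = W, arcs = {(a, b). (a, b) \<in> W \<times> W \<and> a \<noteq> b}, tail = fst, head = snd\<rparr>"
  have ends: "arcs_ends H = arcs H" if "tail H = fst" "head H = snd" for H :: "('a, 'a \<times> 'a) pre_digraph"
    using that by (simp add: arcs_ends_conv)
  have "bij_betw verts ?H ?C"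
  proof (rule bij_betw_byWitness[where f' = ?K])
    show "\<forall>H\<in>?H. ?K (verts H) = H"
    proof
      fix H assume "H \<in> ?H"
      then have "tail H = fst" "head H = snd" "arcs_ends H = {(a, b). (a, b) \<in> verts H \<times> verts H \<and> a \<noteq> b}"
        using assms by (auto simp: subgraph_def compatible_def complete_digraph_def)
      with ends[of H] show "?K (verts H) = H" by simp
    qed
    show "verts ` ?H \<subseteq> ?C"
    proof (rule image_subsetI)
      fix H assume "H \<in> ?H"
      then have "tail H = fst" "head H = snd" "arcs_ends H = {(a, b). (a, b) \<in> verts H \<times> verts H \<and> a \<noteq> b}"
        "verts H \<subseteq> verts G" "arcs H \<subseteq> arcs G" "card (verts H) = m"
        using assms by (auto simp: subgraph_def compatible_def complete_digraph_def)
      with ends[of H] show "verts H \<in> ?C" by auto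
    qed
    show "?K ` ?C \<subseteq> ?H"
    proof (rule image_subsetI)
      fix W assume W: "W \<in> ?C"
      then have fin: "finite W" using assms finite_subset by blast
      then have "finite {(a, b). (a, b) \<in> W \<times> W \<and> a \<noteq> b}"
        by (rule_tac finite_subset[of _ "W \<times> W"]) auto
      with fin have "graph (?K W)"
        by unfold_locales (auto simp: arc_to_ends_def symmetric_conv)
      then have "complete_digraph m (?K W)"
        using W by (simp add: complete_digraph_def ends)
      moreover have "wf_digraph (?K W)" by unfold_locales auto
      then have "subgraph (?K W) G"
        using W assms by (auto simp: subgraph_def compatible_def)
      ultimately show "?K W \<in> ?H" by simp
    qed
  qed auto
  then show ?thesis
    unfolding num_complete_subgraphs_def by (rule bij_betw_same_card)
qed

text \<open>Each set of \<open>m\<close> elements has \<open>fact m\<close> orderings, and different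
  sets have disjoint sets of orderings.\<close>

lemma card_distinct_lists_set:
  assumes "finite V"
  shows "card {xs. distinct xs \<and> length xs = m \<and> set xs \<subseteq> V \<and> Q (set xs)}
    = fact m * card {W. W \<subseteq> V \<and> card W = m \<and> Q W}"
proof -
  let ?C = "{W. W \<subseteq> V \<and> card W = m \<and> Q W}"
  have fin: "finite ?C" using assms by (auto intro: finite_subset[of _ "Pow V"])
  have finW: "finite W" if "W \<in> ?C" for W using that assms finite_subset by blast
  have "{xs. distinct xs \<and> length xs = m \<and> set xs \<subseteq> V \<and> Q (set xs)} = (\<Union>W\<in>?C. permutations_of_set W)"
    by (auto simp: permutations_of_set_def distinct_card)
  also have "card \<dots> = (\<Sum>W\<in>?C. card (permutations_of_set W))"
    by (rule card_UN_disjoint[OF fin]) (auto dest: permutations_of_setD)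
  also have "\<dots> = (\<Sum>W\<in>?C. fact m)"
  proof (rule sum.cong[OF refl])
    fix W assume W: "W \<in> ?C"
    from card_permutations_of_set[OF finW[OF W]] W show "card (permutations_of_set W) = fact m"
      by simp
  qed
  finally show ?thesis by simp
qed

text \<open>Symmetry reduces the clique condition to six pairs, irreflexivity makes the entries of a
  tuple distinct, and 24 is the number of orderings.\<close>

lemma card_4_cliques:
  fixes R :: "'a \<Rightarrow> 'a \<Rightarrow> bool"
  assumes V: "finite V" and sym: "\<And>a b. R a b \<longleftrightarrow> R b a" and irrefl: "\<And>a. \<not> R a a"
  shows "of_nat (24 * card {W. W \<subseteq> V \<and> card W = 4 \<and> (\<forall>a\<in>W. \<forall>b\<in>W. a \<noteq> b \<longrightarrow> R a b)})
    = (\<Sum>d\<in>V. \<Sum>a\<in>V. \<Sum>b\<in>V. \<Sum>c\<in>V.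
        of_bool (R d a \<and> R d b \<and> R d c \<and> R a b \<and> R a c \<and> R b c) :: complex)"
proof -
  let ?Q = "\<lambda>W. \<forall>a\<in>W. \<forall>b\<in>W. a \<noteq> b \<longrightarrow> R a b"
  let ?R = "\<lambda>(d, a, b, c). R d a \<and> R d b \<and> R d c \<and> R a b \<and> R a c \<and> R b c"
  let ?X = "{t \<in> V \<times> V \<times> V \<times> V. ?R t}"
  let ?L = "{xs. distinct xs \<and> length xs = 4 \<and> set xs \<subseteq> V \<and> ?Q (set xs)}"
  have "bij_betw (\<lambda>(d, a, b, c). [d, a, b, c]) ?X ?L"
    unfolding bij_betw_def
  proof
    show "inj_on (\<lambda>(d, a, b, c). [d, a, b, c]) ?X" by (auto simp: inj_on_def)
    show "(\<lambda>(d, a, b, c). [d, a, b, c]) ` ?X = ?L"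
    proof (intro equalityI subsetI)
      fix xs assume "xs \<in> (\<lambda>(d, a, b, c). [d, a, b, c]) ` ?X"
      then show "xs \<in> ?L" using sym irrefl by auto
    next
      fix xs assume xs: "xs \<in> ?L"
      then obtain d a b c where "xs = [d, a, b, c]"
        by (auto simp: numeral_eq_Suc length_Suc_conv)
      with xs have "xs = (\<lambda>(d, a, b, c). [d, a, b, c]) (d, a, b, c)" "(d, a, b, c) \<in> ?X" by auto
      then show "xs \<in> (\<lambda>(d, a, b, c). [d, a, b, c]) ` ?X" by (rule image_eqI)
    qed
  qed
  then have "card ?X = card ?L" by (rule bij_betw_same_card)
  also have "\<dots> = 24 * card {W. W \<subseteq> V \<and> card W = 4 \<and> ?Q W}"
    using card_distinct_lists_set[OF V, of 4 ?Q] by (simp add: fact_numeral)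
  finally have "of_nat (24 * card {W. W \<subseteq> V \<and> card W = 4 \<and> ?Q W}) = (of_nat (card ?X) :: complex)"
    by simp
  also have "\<dots> = (\<Sum>t\<in>V \<times> V \<times> V \<times> V. of_bool (?R t))"
    using V by (subst sum_of_bool_eq) (auto intro!: arg_cong[where f = card])
  also have "\<dots> = (\<Sum>d\<in>V. \<Sum>a\<in>V. \<Sum>b\<in>V. \<Sum>c\<in>V. of_bool (?R (d, a, b, c)))"
    by (simp only: sum.cartesian_product' prod.case)
  finally show ?thesis by simp
qed

section \<open>The count modulo a prime power\<close>

theorem theorem1p2:
  fixes p \<alpha> :: nat and \<chi> \<psi> :: "int \<Rightarrow> complex"
  assumes "prime p" and "[p = 1] (mod 4)" and "\<alpha> > 0"
    and "dirichlet_character (p ^ \<alpha>) \<chi>" and "character_order (p ^ \<alpha>) \<chi> = 2"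
    and "dirichlet_character (p ^ \<alpha>) \<psi>" and "character_order (p ^ \<alpha>) \<psi> = 4"
  shows "of_nat (num_complete_subgraphs 4 (unit_square_graph (p ^ \<alpha>))) =
    of_nat p ^ (2 * \<alpha> - 1) * (of_nat p - 1) *
      (of_nat p ^ (2 * \<alpha> - 2) * ((of_nat p - 9) ^ 2 - 2 * of_nat p)
        + jacobi_sum (p ^ \<alpha>) \<psi> \<chi> ^ 2 + cnj (jacobi_sum (p ^ \<alpha>) \<psi> \<chi>) ^ 2) / 1536"
proof -
  interpret quartic_character p \<chi> \<psi>
    using assms by (rule quartic_character_prime_power)
  define q where "q = p ^ (\<alpha> - 1)"
  have n: "p ^ \<alpha> = q * p"
    using \<open>\<alpha> > 0\<close> by (simp add: q_def flip: power_Suc2)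
  have "p mod 4 = 1" using assms(2) by (simp add: cong_def)
  then have "odd p" by presburger
  let ?G = "unit_square_graph (p ^ \<alpha>)" and ?V = "{0..<int (p ^ \<alpha>)}"
  let ?K = "num_complete_subgraphs 4 ?G"
  \<comment> \<open>Adjacency becomes a condition on \<open>\<chi>\<close>, hence on the difference
    modulo \<open>p\<close>; the square root is reduced modulo \<open>p ^ \<alpha>\<close> to lie in
    \<open>?V\<close>.\<close>
  have chi_square: "\<chi> (a - b) = 1 \<longleftrightarrow>
      (\<exists>x\<in>?V. coprime x (int (p ^ \<alpha>)) \<and> [a - b = x ^ 2] (mod int (p ^ \<alpha>)))" for a b
  proof
    assume "\<chi> (a - b) = 1"
    then obtain x where x: "coprime x (int (p ^ \<alpha>))" "[a - b = x ^ 2] (mod int (p ^ \<alpha>))"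
      using quadratic_character_values(3)[OF assms(1) \<open>odd p\<close> assms(3-7)] by blast
    have pos: "int (p ^ \<alpha>) > 0" using p_pos by simp
    show "\<exists>x\<in>?V. coprime x (int (p ^ \<alpha>)) \<and> [a - b = x ^ 2] (mod int (p ^ \<alpha>))"
    proof (rule bexI[of _ "x mod int (p ^ \<alpha>)"], intro conjI)
      show "coprime (x mod int (p ^ \<alpha>)) (int (p ^ \<alpha>))"
        using x(1) pos by (simp only: coprime_mod_left_iff)
      show "[a - b = (x mod int (p ^ \<alpha>)) ^ 2] (mod int (p ^ \<alpha>))"
        using x(2) unfolding cong_def by (simp only: power_mod)
      show "x mod int (p ^ \<alpha>) \<in> ?V"
        using pos_mod_bound[OF pos, of x] pos_mod_sign[OF pos, of x] by (simp only: atLeastLessThan_iff)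
    qed
  next
    assume "\<exists>x\<in>?V. coprime x (int (p ^ \<alpha>)) \<and> [a - b = x ^ 2] (mod int (p ^ \<alpha>))"
    then show "\<chi> (a - b) = 1"
      using quadratic_character_values(3)[OF assms(1) \<open>odd p\<close> assms(3-7)] by blast
  qed
  \<comment> \<open>The condition \<open>a \<noteq> b\<close> is absorbed, because
    \<open>\<chi> 0 = 0\<close>.\<close>
  have arcs: "(a, b) \<in> arcs ?G \<longleftrightarrow> a \<in> ?V \<and> b \<in> ?V \<and> \<chi> (a - b) = 1" for a b
    unfolding chi_square[symmetric] unit_square_graph_def by (auto simp flip: chi_square)
  have verts: "verts ?G = ?V" and "tail ?G = fst" "head ?G = snd"
    by (simp_all add: unit_square_graph_def)
  moreover have "wf_digraph ?G"
    by unfold_locales (auto simp: unit_square_graph_def)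
  ultimately have "?K = card {W. W \<subseteq> verts ?G \<and> card W = 4 \<and>
      (\<forall>a\<in>W. \<forall>b\<in>W. a \<noteq> b \<longrightarrow> (a, b) \<in> arcs ?G)}"
    by (intro num_complete_subgraphs_eq_card_cliques) auto
  also have "\<dots> = card {W. W \<subseteq> ?V \<and> card W = 4 \<and> (\<forall>a\<in>W. \<forall>b\<in>W. a \<noteq> b \<longrightarrow> \<chi> (a - b) = 1)}"
    unfolding verts arcs by (rule arg_cong[where f = card]) blast
  finally have "of_nat (24 * ?K) = (\<Sum>d\<in>?V. \<Sum>a\<in>?V. \<Sum>b\<in>?V. \<Sum>c\<in>?V.
      of_bool (\<chi> (d - a) = 1 \<and> \<chi> (d - b) = 1 \<and> \<chi> (d - c) = 1
        \<and> \<chi> (a - b) = 1 \<and> \<chi> (a - c) = 1 \<and> \<chi> (b - c) = 1) :: complex)"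
    by (simp only:) (rule card_4_cliques; simp add: chi_minus_commute)
  also have "\<dots> = (\<Sum>d\<in>?V. \<Sum>a\<in>?V. \<Sum>b\<in>?V. \<Sum>c\<in>?V. clique d a b c)"
    by (simp only: clique_def S_def of_bool_conj mult.assoc)
  \<comment> \<open>Each of the four periodic sums contributes one factor \<open>q\<close>.\<close>
  also have "\<dots> = of_nat q ^ 4 * (\<Sum>d\<in>P. \<Sum>a\<in>P. \<Sum>b\<in>P. \<Sum>c\<in>P. clique d a b c)"
    unfolding n
    by (simp add: sum_periodic_multiple periodic_intros clique_periodic power4_eq_xxxx mult.assoc
        del: of_nat_mult flip: sum_distrib_left)
  \<comment> \<open>Here 1536 is 24 orderings times the denominator 64 of
    \<open>sum_cliques\<close>.\<close>
  finally have "of_nat ?K = of_nat q ^ 4 * of_nat p * (of_nat p - 1)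
      * ((of_nat p - 9) ^ 2 - 2 * of_nat p + T) / (1536 :: complex)"
    unfolding sum_cliques by (simp add: mult_ac)
  also have "T = jacobi_sum p \<psi> \<chi> ^ 2 + cnj (jacobi_sum p \<psi> \<chi>) ^ 2"
    by (rule jacobi_square_plus_cnj[symmetric])
  finally have K: "of_nat ?K = of_nat q ^ 4 * of_nat p * (of_nat p - 1)
      * ((of_nat p - 9) ^ 2 - 2 * of_nat p
        + (jacobi_sum p \<psi> \<chi> ^ 2 + cnj (jacobi_sum p \<psi> \<chi>) ^ 2)) / (1536 :: complex)" .
  have J: "jacobi_sum (p ^ \<alpha>) \<psi> \<chi> = of_nat q * jacobi_sum p \<psi> \<chi>"
    unfolding jacobi_sum_def n by (rule sum_periodic_multiple) (intro periodicity chi_periodic psi_periodic)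
  \<comment> \<open>Of \<open>q ^ 4 * p\<close>, the part \<open>q ^ 2 * p\<close> is the outer
    power of \<open>p\<close>. The other \<open>q ^ 2\<close> enters the bracket, as
    \<open>p ^ (2 * \<alpha> - 2)\<close> and inside the squared Jacobi sums. Positivity of
    \<open>\<alpha>\<close> keeps the subtractions exact.\<close>
  have "2 * \<alpha> - 2 = (\<alpha> - 1) * 2" "2 * \<alpha> - 1 = Suc ((\<alpha> - 1) * 2)"
    using \<open>\<alpha> > 0\<close> by auto
  then have "of_nat p ^ (2 * \<alpha> - 2) = (of_nat q ^ 2 :: complex)"
    "of_nat p ^ (2 * \<alpha> - 1) = (of_nat p * of_nat q ^ 2 :: complex)"
    by (simp_all add: q_def power_mult)
  then show ?thesis
    unfolding K J by (simp add: algebra_simps power2_eq_square power4_eq_xxxx)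
qed

end
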